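(* Let $\Phi$ be a family of real sequences $\{a_n\}_{n\in\omega}$, each converging to $+\infty$, such that: (C) for every open set $U\subseteq\mathbb{R}$ that is unbounded above there exists a sequence in $\Phi$ having infinitely many terms in $U$; (1) the family $\{f_{\{a_n\}} : \{a_n\}\in\Phi\}\subseteq\omega^\omega$ is bounded; (2) for every $\{a_n\}\in\Phi$ and every $n\in\omega\setminus\{0\}$ we have $0<a_{n+1}-a_n\leq a_n-a_{n-1}$. Then $\mathrm{card}\,\Phi\geq \mathrm{non}(M)$.
   Context: $\omega=\{0,1,2,\dots\}$. For $f,g:\omega\to\omega$, write $f\leq_* g$ if $\{i: f(i)>g(i)\}$ is finite; a family $F\subseteq\omega^\omega$ is bounded if there is $g\in\omega^\omega$ with $f\leq_* g$ for all $f\in F$. $M$ is the ideal of first category (meager) subsets of $\mathbb{R}$ and $\mathrm{non}(M)=\min\{\mathrm{card}\,X: X\subseteq\mathbb{R}, X\notin M\}$. For a real sequence $\{a_n\}_{n\in\omega}$ converging to $+\infty$, define $f_{\{a_n\}}:\omega\to\omega$ by: if $\bigcup_{n\in\omega}(a_n-1,a_n+1)\supseteq(i,\infty)$ then $f_{\{a_n\}}(i)=\max\{j\in\omega\setminus\{0\}: \bigcup_{n\in\omega}(a_n-\frac1j,a_n+\frac1j)\supseteq(i,\infty)\}$, and otherwise $f_{\{a_n\}}(i)=0$. *)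

theory Defs
  imports "HOL-Analysis.Analysis"
begin

unbundle cardinal_syntax

definition nowhere_dense :: "'a::topological_space set \<Rightarrow> bool"
  where "nowhere_dense A \<longleftrightarrow> interior (closure A) = {}"

definition meager :: "'a::topological_space set \<Rightarrow> bool"
  where "meager A \<longleftrightarrow> (\<exists>\<N>. countable \<N> \<and> (\<forall>N\<in>\<N>. nowhere_dense N) \<and> A = \<Union>\<N>)"

text \<open>
  Cardinals are the cardinal orders of \<open>HOL.BNF_Cardinal_Order_Relation\<close>, compared by \<open>\<le>o\<close>
  (possibly across types). As they are unique only up to \<open>=o\<close>, a least cardinal has to
  be picked by choice, as in the library's \<open>cardSuc\<close>; existence is shown in \<open>non_M_least\<close>.
\<close>

definition nonmeager_cards :: "real rel set"
  where "nonmeager_cards = {|X| |X :: real set. \<not> meager X}"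

definition non_M :: "real rel"
  where "non_M = (SOME \<kappa>. \<kappa> \<in> nonmeager_cards \<and> (\<forall>\<mu>\<in>nonmeager_cards. \<kappa> \<le>o \<mu>))"

definition le_star :: "(nat \<Rightarrow> nat) \<Rightarrow> (nat \<Rightarrow> nat) \<Rightarrow> bool"  (infix "\<le>\<^sub>*" 50)
  where "f \<le>\<^sub>* g \<longleftrightarrow> finite {i. f i > g i}"

definition bounded_family :: "(nat \<Rightarrow> nat) set \<Rightarrow> bool"
  where "bounded_family F \<longleftrightarrow> (\<exists>g. \<forall>f\<in>F. f \<le>\<^sub>* g)"

definition covers_beyond :: "(nat \<Rightarrow> real) \<Rightarrow> real \<Rightarrow> nat \<Rightarrow> bool"
  where "covers_beyond a r i \<longleftrightarrow> {real i<..} \<subseteq> (\<Union>n. {a n - r<..<a n + r})"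

text \<open>For \<open>a\<close> tending to infinity the maximum is over a finite set, see \<open>finite_covers_beyond\<close>.\<close>

definition cover_fun :: "(nat \<Rightarrow> real) \<Rightarrow> nat \<Rightarrow> nat"
  where "cover_fun a i =
    (if covers_beyond a 1 i then Max {j. j \<noteq> 0 \<and> covers_beyond a (1 / real j) i} else 0)"

lemma not_meager_UNIV: "\<not> meager (UNIV :: real set)"
proof
  assume "meager (UNIV :: real set)"
  then obtain \<N> :: "real set set" where N: "countable \<N>" "\<And>N. N \<in> \<N> \<Longrightarrow> nowhere_dense N" "UNIV = \<Union>\<N>"
    unfolding meager_def by blast
  have "(UNIV :: real set) \<subseteq> closure (\<Inter>((\<lambda>N. - closure N) ` \<N>))"
  proof (rule Baire)
    show "countable ((\<lambda>N. - closure N) ` \<N>)"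
      using N(1) by simp
    fix T assume "T \<in> (\<lambda>N. - closure N) ` \<N>"
    then show "openin (top_of_set UNIV) T \<and> UNIV \<subseteq> closure T"
      using N(2) by (auto simp: nowhere_dense_def closure_complement)
  qed simp
  moreover have "\<Inter>((\<lambda>N. - closure N) ` \<N>) = {}"
    using N(3) closure_subset by blast
  ultimately show False
    by simp
qed

lemma non_M_least:
  "non_M \<in> nonmeager_cards \<and> (\<forall>\<mu>\<in>nonmeager_cards. non_M \<le>o \<mu>)"
proof -
  have "\<exists>\<kappa>\<in>nonmeager_cards. \<forall>\<mu>\<in>nonmeager_cards. \<kappa> \<le>o \<mu>"
    using not_meager_UNIV by (intro exists_minim_Card_order) (auto simp: nonmeager_cards_def card_of_Card_order)
  then show ?thesis
    unfolding non_M_def Bex_def by (rule someI_ex)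
qed

lemma finite_covers_beyond:
  assumes "filterlim a at_top sequentially"
  shows "finite {j. j \<noteq> 0 \<and> covers_beyond a (1 / real j) i}"
proof -
  have "eventually (\<lambda>n. a n > real i + 3) sequentially"
    using assms by (simp add: filterlim_at_top_dense)
  then obtain K where K: "\<And>n. n \<ge> K \<Longrightarrow> a n > real i + 3"
    by (auto simp: eventually_sequentially)
  have "infinite ({real i + 1<..<real i + 2} - a ` {..<K})"
    by (intro Diff_infinite_finite) (auto simp: infinite_Ioo)
  then have "{real i + 1<..<real i + 2} - a ` {..<K} \<noteq> {}"
    by (rule infinite_imp_nonempty)
  then obtain x where "x \<in> {real i + 1<..<real i + 2} - a ` {..<K}"
    by blast
  then have x: "real i + 1 < x" "x < real i + 2" "x \<notin> a ` {..<K}"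
    by simp_all
  define D where "D = insert 1 ((\<lambda>n. \<bar>x - a n\<bar>) ` {..<K})"
  define d where "d = Min D"
  have D: "finite D" "D \<noteq> {}" "\<And>y. y \<in> D \<Longrightarrow> y > 0"
    using x(3) by (auto simp: D_def)
  have "d > 0"
    using D Min_in unfolding d_def by blast
  have "d \<le> \<bar>x - a n\<bar>" for n
  proof (cases "n < K")
    case True
    then show ?thesis
      unfolding d_def using D(1) by (intro Min_le) (auto simp: D_def)
  next
    case False
    have "d \<le> 1"
      unfolding d_def using D(1) by (intro Min_le) (auto simp: D_def)
    then show ?thesis
      using K[of n] False x(2) by linarith
  qed
  then have far: "\<not> \<bar>x - a n\<bar> < d" for n
    by (simp add: not_less)
  have "j \<le> nat \<lceil>1 / d\<rceil>" if j: "j \<noteq> 0" "covers_beyond a (1 / real j) i" for j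
  proof -
    have "x \<in> {real i<..}"
      using x(1) by simp
    then have "x \<in> (\<Union>n. {a n - 1 / real j<..<a n + 1 / real j})"
      using j(2) unfolding covers_beyond_def by (rule rev_subsetD)
    then obtain n where "x \<in> {a n - 1 / real j<..<a n + 1 / real j}"
      by (rule UN_E)
    then have "a n - 1 / real j < x" "x < a n + 1 / real j"
      by simp_all
    then have "\<bar>x - a n\<bar> < 1 / real j"
      by linarith
    then have "d < 1 / real j"
      using far[of n] by linarith
    then have "real j < 1 / d"
      using \<open>d > 0\<close> j(1) by (simp add: field_simps)
    then show ?thesis
      by linarith
  qed
  then show ?thesis
    by (intro finite_subset[OF _ finite_atMost[of "nat \<lceil>1 / d\<rceil>"]]) auto
qed

end

theory Submission
  imports Defs
begin

text \<open>
  The gaps of a sequence in \<open>\<Phi>\<close> decrease, so a bound on \<open>cover_fun a i\<close> bounds all gaps below \<open>i\<close> away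
  from 0, and hence bounds, by some \<open>H i\<close> not depending on \<open>a\<close>, the number of terms below \<open>i\<close>. Coding
  naturals by disjoint open subintervals of \<open>(i, i + 1)\<close>, condition (C) then says that every
  \<open>g : \<omega> \<rightarrow> \<omega>\<close> is guessed infinitely often by some \<open>a \<in> \<Phi>\<close>: \<open>a n\<close> codes \<open>g i\<close> for some \<open>i\<close> with
  \<open>n < H i\<close>.

  As in Bartoszynski's characterisation of \<open>non(M)\<close>, each pair \<open>(a, b)\<close> from \<open>\<Phi>\<close> yields a real:
  \<open>a\<close> cuts the binary digits into blocks, and \<open>b\<close> determines the digits in the blocks. Given dense
  open sets \<open>D n\<close>, some \<open>a\<close> makes infinitely many blocks so long that a suitable word in the block
  forces the real into \<open>D n\<close> regardless of all earlier digits. Some \<open>b\<close> then guesses infinitely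
  often a list of more than \<open>n\<close> such blocks with their words; as only \<open>n\<close> blocks have been filled
  before, one listed block is still free and receives the right word. So these reals form a
  nonmeager set of cardinality at most \<open>|\<Phi> \<times> \<Phi>|\<close>.
\<close>

section \<open>Counting the terms below a bound\<close>

text \<open>Some \<open>x > i\<close> has distance at least \<open>r = 1 / (g + 1)\<close> from
  every term, so the gap around \<open>x\<close> is at least \<open>r\<close> long, and hence so are
  all earlier gaps. The terms below \<open>i\<close> are thus \<open>r\<close>-separated and lie in
  \<open>(-i, i)\<close>.\<close>

lemma index_bound_of_term_below:
  fixes a :: "nat \<Rightarrow> real"
  assumes lim: "filterlim a at_top sequentially"
    and gaps: "\<And>n. n \<noteq> 0 \<Longrightarrow> 0 < a (n + 1) - a n \<and> a (n + 1) - a n \<le> a n - a (n - 1)"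
    and g: "cover_fun a i \<le> g" and i: "\<bar>a 0\<bar> < real i" and m: "a m < real i"
  shows "m < 2 * i * (g + 1)"
proof -
  define r where "r = 1 / real (g + 1)"
  have r: "0 < r" "r \<le> 1"
    by (auto simp: r_def field_simps)
  have step: "a n < a (Suc n)" for n
    using gaps[of n] gaps[of 1] by (cases "n = 0") auto
  then have sm: "strict_mono a"
    by (simp add: strict_mono_Suc_iff)
  have anti: "antimono (\<lambda>n. a (Suc n) - a n)"
    unfolding antimono_iff_le_Suc using gaps[of "Suc _"] by auto
  \<comment> \<open>Either \<open>g + 1\<close> exceeds the maximum defining
    \<open>cover_fun a i\<close>, or \<open>cover_fun a i\<close> has its default value 0 because
    radius 1 fails, and then \<open>r \<le> 1\<close> fails too.\<close>
  have "\<not> covers_beyond a r i"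
  proof (cases "covers_beyond a 1 i")
    case True
    show ?thesis
    proof
      assume "covers_beyond a r i"
      then have "g + 1 \<le> Max {j. j \<noteq> 0 \<and> covers_beyond a (1 / real j) i}"
        using finite_covers_beyond[OF lim] by (intro Max_ge) (auto simp: r_def)
      then show False
        using g True by (simp add: cover_fun_def)
    qed
  next
    case False
    have "{a n - r<..<a n + r} \<subseteq> {a n - 1<..<a n + 1}" for n
      using r by auto
    then have "(\<Union>n. {a n - r<..<a n + r}) \<subseteq> (\<Union>n. {a n - 1<..<a n + 1})"
      by (intro UN_mono) auto
    then have "covers_beyond a r i \<Longrightarrow> covers_beyond a 1 i"
      unfolding covers_beyond_def by (rule order_trans[rotated])
    then show ?thesis
      using False by blast
  qed
  then obtain x where x: "real i < x" and "x \<notin> (\<Union>n. {a n - r<..<a n + r})"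
    unfolding covers_beyond_def by blast
  then have "\<not> (a n - r < x \<and> x < a n + r)" for n
    by simp
  then have far: "\<bar>x - a n\<bar> \<ge> r" for n
    by (smt (verit))
  have "eventually (\<lambda>n. a n > x) sequentially"
    using lim by (simp add: filterlim_at_top_dense)
  then have "\<exists>n. a n > x"
    by (auto simp: eventually_sequentially)
  moreover have "\<not> a 0 > x"
    using i x by linarith
  ultimately obtain n where n: "a n \<le> x" "x < a (Suc n)"
    using exists_least_lemma[of "\<lambda>n. a n > x"] by (auto simp: not_less)
  have gap: "r \<le> a (Suc l) - a l" if "l \<le> n" for l
  proof -
    have "r \<le> a (Suc n) - a n"
      using far[of n] n step[of n] by auto
    also have "\<dots> \<le> a (Suc l) - a l"
      using antimonoD[OF anti that] .
    finally show ?thesis .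
  qed
  have "a 0 + real l * r \<le> a l" if "l \<le> Suc n" for l
    using that
  proof (induction l)
    case (Suc l)
    then show ?case using gap[of l] by (simp add: algebra_simps)
  qed simp
  moreover have "m \<le> Suc n"
    using sm m x n by (metis less_trans not_less_iff_gr_or_eq order.strict_implies_order strict_mono_less)
  ultimately have "a 0 + real m * r < real i"
    using m by fastforce
  then have "real m * r < 2 * real i"
    using i by linarith
  then have "real m < 2 * real i * real (g + 1)"
    by (simp add: r_def field_simps)
  also have "\<dots> = real (2 * i * (g + 1))"
    by (simp only: of_nat_mult of_nat_numeral)
  finally show ?thesis
    by (simp only: of_nat_less_iff)
qed

lemma eventually_few_terms_below:
  fixes \<Phi> :: "(nat \<Rightarrow> real) set"
  assumes "\<And>a. a \<in> \<Phi> \<Longrightarrow> filterlim a at_top sequentially"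
    and "bounded_family (cover_fun ` \<Phi>)"
    and "\<And>a n. a \<in> \<Phi> \<Longrightarrow> n \<noteq> 0 \<Longrightarrow> 0 < a (n + 1) - a n \<and> a (n + 1) - a n \<le> a n - a (n - 1)"
  obtains H :: "nat \<Rightarrow> nat"
  where "\<And>a. a \<in> \<Phi> \<Longrightarrow> \<exists>i\<^sub>0. \<forall>i\<ge>i\<^sub>0. \<forall>n. a n < real i \<longrightarrow> n < H i"
proof -
  obtain g where g: "\<And>a. a \<in> \<Phi> \<Longrightarrow> cover_fun a \<le>\<^sub>* g"
    using assms(2) unfolding bounded_family_def by blast
  show thesis
  proof
    fix a assume a: "a \<in> \<Phi>"
    then have "finite {i. cover_fun a i > g i}"
      using g unfolding le_star_def by blast
    then obtain k where k: "\<And>i. cover_fun a i > g i \<Longrightarrow> i < k"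
      unfolding finite_nat_set_iff_bounded by blast
    \<comment> \<open>This bound, the witness for \<open>H i\<close>, is the same for all
      \<open>a\<close>. Only the threshold for \<open>i\<close> depends on \<open>a\<close>: it
      passes \<open>\<bar>a 0\<bar>\<close> and the finitely many exceptions to the bound
      \<open>g\<close>.\<close>
    have "n < 2 * i * (g i + 1)" if "i \<ge> max k (nat \<lceil>\<bar>a 0\<bar>\<rceil> + 1)" "a n < real i" for i n
    proof (rule index_bound_of_term_below[OF assms(1)[OF a] assms(3)[OF a]])
      show "cover_fun a i \<le> g i"
        using k[of i] that by (meson leD leI max.boundedE)
      show "\<bar>a 0\<bar> < real i"
        using that by linarith
    qed (use that in auto)
    then show "\<exists>i\<^sub>0. \<forall>i\<ge>i\<^sub>0. \<forall>n. a n < real i \<longrightarrow> n < 2 * i * (g i + 1)"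
      by blast
  qed
qed

section \<open>From condition (C) to guessing functions\<close>

text \<open>Here \<open>1 / frac x\<close> lies strictly between \<open>c + 1\<close> and
  \<open>c + 2\<close>. The shift by 1 keeps the interval inside \<open>(i, i + 1)\<close> even for
  \<open>c = 0\<close>.\<close>

lemma frac_decode:
  assumes "real i + 1 / real (c + 2) < x" "x < real i + 1 / real (c + 1)"
  shows "nat \<lfloor>1 / frac x\<rfloor> - 1 = c"
proof -
  have *: "0 < 1 / real (c + 2)" "1 / real (c + 1) \<le> 1"
    by (auto simp: field_simps)
  then have "\<lfloor>x\<rfloor> = int i"
    using assms by (intro floor_unique; unfold of_int_of_nat_eq; linarith)
  then have fr: "frac x = x - real i"
    by (simp add: frac_def)
  have pos: "0 < x - real i"
    using assms * by linarith
  have "1 < (x - real i) * real (c + 2)" "(x - real i) * real (c + 1) < 1"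
    using assms by (simp_all add: field_simps)
  then have "\<lfloor>1 / (x - real i)\<rfloor> = int (c + 1)"
    using pos by (intro floor_unique) (simp_all add: field_simps)
  then show ?thesis
    by (simp add: fr)
qed

text \<open>Condition (C) is applied to the union of the intervals coding the values
  \<open>g i\<close>. A term in the interval at \<open>i\<close> is below \<open>Suc i\<close>, so
  its index is compared with \<open>H (Suc i)\<close>.\<close>

lemma guessing_sequences:
  fixes \<Phi> :: "(nat \<Rightarrow> real) set" and H :: "nat \<Rightarrow> nat"
  assumes lim: "\<And>a. a \<in> \<Phi> \<Longrightarrow> filterlim a at_top sequentially"
    and hit: "\<And>U. open U \<Longrightarrow> \<not> bdd_above U \<Longrightarrow> \<exists>a\<in>\<Phi>. infinite {n. a n \<in> U}"
    and H: "\<And>a. a \<in> \<Phi> \<Longrightarrow> \<exists>i\<^sub>0. \<forall>i\<ge>i\<^sub>0. \<forall>n. a n < real i \<longrightarrow> n < H i"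
  shows "\<exists>a\<in>\<Phi>. infinite {n. \<exists>i. nat \<lfloor>1 / frac (a n)\<rfloor> - 1 = g i \<and> n < H (Suc i)}"
proof -
  define V where "V i = {real i + 1 / real (g i + 2)<..<real i + 1 / real (g i + 1)}" for i
  have "\<not> bdd_above (\<Union>i. V i)"
  proof
    assume "bdd_above (\<Union>i. V i)"
    then obtain M where M: "\<And>i x. x \<in> V i \<Longrightarrow> x \<le> M"
      unfolding bdd_above_def by blast
    have "V i \<noteq> {}" for i
      by (auto simp: V_def field_simps)
    then obtain x where x: "x \<in> V (nat \<lceil>M\<rceil>)"
      by blast
    then have "real (nat \<lceil>M\<rceil>) < x"
      unfolding V_def by (smt (verit) greaterThanLessThan_iff of_nat_0_le_iff zero_le_divide_1_iff)
    then show False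
      using M[OF x] by linarith
  qed
  moreover have "open (\<Union>i. V i)"
    by (auto simp: V_def)
  ultimately have "\<exists>a\<in>\<Phi>. infinite {n. a n \<in> (\<Union>i. V i)}"
    by (intro hit)
  then obtain a where a: "a \<in> \<Phi>" "infinite {n. a n \<in> (\<Union>i. V i)}"
    by (rule bexE)
  obtain i0 where i0: "\<And>i n. i \<ge> i0 \<Longrightarrow> a n < real i \<Longrightarrow> n < H i"
    using H[OF a(1)] by blast
  have "eventually (\<lambda>n. a n > real i0) sequentially"
    using lim[OF a(1)] by (simp add: filterlim_at_top_dense)
  then obtain k where k: "\<And>n. n \<ge> k \<Longrightarrow> a n > real i0"
    by (auto simp: eventually_sequentially)
  \<comment> \<open>Dropping the terms before \<open>k\<close> leaves terms above \<open>i0\<close>,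
    which puts \<open>Suc i\<close> past the threshold for \<open>H\<close>.\<close>
  have "{n. a n \<in> (\<Union>i. V i)} - {..<k} \<subseteq> {n. \<exists>i. nat \<lfloor>1 / frac (a n)\<rfloor> - 1 = g i \<and> n < H (Suc i)}"
  proof
    fix n assume "n \<in> {n. a n \<in> (\<Union>i. V i)} - {..<k}"
    then obtain i where i: "a n \<in> V i" and n: "n \<ge> k"
      by auto
    have "1 / real (g i + 1) \<le> 1"
      by simp
    moreover have "a n < real i + 1 / real (g i + 1)"
      using i by (simp add: V_def)
    ultimately have "a n < real i + 1"
      by linarith
    then have "a n < real (Suc i)"
      by simp
    moreover from this have "Suc i \<ge> i0"
      using k[OF n] by linarith
    ultimately have "n < H (Suc i)"
      using i0 by blast
    then show "n \<in> {n. \<exists>i. nat \<lfloor>1 / frac (a n)\<rfloor> - 1 = g i \<and> n < H (Suc i)}"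
      using frac_decode[of i "g i" "a n"] i by (auto simp: V_def)
  qed
  then have "infinite {n. \<exists>i. nat \<lfloor>1 / frac (a n)\<rfloor> - 1 = g i \<and> n < H (Suc i)}"
    using a(2) by (meson Diff_infinite_finite finite_lessThan finite_subset)
  then show ?thesis
    using a(1) by blast
qed

section \<open>Digits from guessed lists\<close>

text \<open>Greedy choice: at stage \<open>n\<close> at most \<open>n\<close> elements are taken, so
  a set with more than \<open>n\<close> elements has one left. Infinite sets have
  \<open>card\<close> 0 and drop out.\<close>

lemma distinct_representatives:
  fixes A :: "nat \<Rightarrow> 'a set"
  obtains \<kappa> where "\<And>n. n < card (A n) \<Longrightarrow> \<kappa> n \<in> A n" "inj_on \<kappa> {n. n < card (A n)}"
proof -
  have "\<exists>\<kappa>. \<forall>n. n < card (A n) \<longrightarrow> \<kappa> n \<in> A n - \<kappa> ` {..<n}"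
  proof (rule dependent_wellorder_choice)
    fix n and \<kappa> :: "nat \<Rightarrow> 'a"
    have "A n - \<kappa> ` {..<n} \<noteq> {}" if "n < card (A n)"
    proof
      assume "A n - \<kappa> ` {..<n} = {}"
      then have "card (A n) \<le> card (\<kappa> ` {..<n})"
        by (intro card_mono) auto
      also have "\<dots> \<le> n"
        using card_image_le[of "{..<n}" \<kappa>] by simp
      finally show False
        using that by simp
    qed
    then show "\<exists>r. n < card (A n) \<longrightarrow> r \<in> A n - \<kappa> ` {..<n}"
      by blast
  next
    fix r n and \<kappa> \<kappa>' :: "nat \<Rightarrow> 'a"
    assume "\<And>m. m < n \<Longrightarrow> \<kappa> m = \<kappa>' m"
    then have "\<kappa> ` {..<n} = \<kappa>' ` {..<n}"
      by (intro image_cong) auto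
    then show "(n < card (A n) \<longrightarrow> r \<in> A n - \<kappa> ` {..<n}) = (n < card (A n) \<longrightarrow> r \<in> A n - \<kappa>' ` {..<n})"
      by simp
  qed
  then obtain \<kappa> where \<kappa>: "\<And>n. n < card (A n) \<Longrightarrow> \<kappa> n \<in> A n - \<kappa> ` {..<n}"
    by blast
  show thesis
  proof
    show "inj_on \<kappa> {n. n < card (A n)}"
    proof (rule linorder_inj_onI)
      fix x y assume "x < y" "y \<in> {n. n < card (A n)}"
      then have "\<kappa> y \<notin> \<kappa> ` {..<y}"
        using \<kappa> by blast
      then show "\<kappa> x \<noteq> \<kappa> y"
        using \<open>x < y\<close> by (metis imageI lessThan_iff)
    qed auto
  qed (use \<kappa> in blast)
qed

text \<open>Each list \<open>f n\<close> with more than \<open>n\<close> keys gets a key of its own,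
  where \<delta> adopts the listed value. So \<delta> depends on \<open>f\<close> alone, and each
  correct list contributes a new agreement with \<open>c\<close>.\<close>

lemma digits_from_guesses:
  fixes f :: "nat \<Rightarrow> ('a \<times> 'b) list"
  shows "\<exists>\<delta>. \<forall>K c. infinite {n. n < card (fst ` set (f n)) \<and> (\<forall>(k, v)\<in>set (f n). k \<in> K \<and> v = c k)}
    \<longrightarrow> infinite {k\<in>K. \<delta> k = c k}"
proof -
  define N where "N = {n. n < card (fst ` set (f n))}"
  obtain \<kappa> where \<kappa>: "\<And>n. n \<in> N \<Longrightarrow> \<kappa> n \<in> fst ` set (f n)" "inj_on \<kappa> N"
    unfolding N_def by (rule distinct_representatives[of "\<lambda>n. fst ` set (f n)"]) (simp, iprover)
  \<comment> \<open>\<open>inv_into\<close> finds the list that owns \<open>k\<close>; off the range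
    of \<open>\<kappa>\<close> the value is arbitrary. Repeated keys do no harm, as a correct list
    gives all of them the value \<open>c k\<close>.\<close>
  define \<delta> where "\<delta> k = the (map_of (f (inv_into N \<kappa> k)) k)" for k
  have "infinite {k\<in>K. \<delta> k = c k}"
    if inf: "infinite {n. n < card (fst ` set (f n)) \<and> (\<forall>(k, v)\<in>set (f n). k \<in> K \<and> v = c k)}"
      (is "infinite ?M") for K c
  proof -
    have M: "?M \<subseteq> N"
      by (auto simp: N_def)
    have "\<kappa> n \<in> {k\<in>K. \<delta> k = c k}" if n: "n \<in> ?M" for n
    proof -
      have nN: "n \<in> N"
        using n M by blast
      obtain v where "map_of (f n) (\<kappa> n) = Some v"
        using \<kappa>(1)[OF nN] by (metis not_None_eq map_of_eq_None_iff)
      moreover from this have "(\<kappa> n, v) \<in> set (f n)"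
        by (rule map_of_SomeD)
      ultimately show ?thesis
        using n \<kappa>(2) nN by (auto simp: \<delta>_def)
    qed
    then have "\<kappa> ` ?M \<subseteq> {k\<in>K. \<delta> k = c k}"
      by blast
    moreover have "infinite (\<kappa> ` ?M)"
      using inf inj_on_subset[OF \<kappa>(2) M] finite_imageD by blast
    ultimately show ?thesis
      using finite_subset by blast
  qed
  then show ?thesis
    by blast
qed

section \<open>Block boundaries\<close>

primrec scale :: "(nat \<Rightarrow> nat) \<Rightarrow> nat \<Rightarrow> nat" where
  "scale f 0 = 0"
| "scale f (Suc k) = max (Suc (scale f k)) (Max (f ` {..scale f k}))"

lemma strict_mono_scale: "strict_mono (scale f)"
  by (simp add: strict_mono_Suc_iff less_max_iff_disj)

lemma scale_Suc_ge: "n \<le> scale f k \<Longrightarrow> f n \<le> scale f (Suc k)"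
  by (simp add: le_max_iff_disj)

text \<open>Let \<open>n\<close> lie in block \<open>k\<close>. If that block is too short, it ends
  before \<open>E n\<close>, so \<open>E\<close> of its end is at most
  \<open>E (E n) \<le> f n\<close>, which the next boundary reaches: block \<open>Suc k\<close> is
  long. This is why \<open>E\<close> is iterated.\<close>

lemma infinite_long_blocks:
  assumes E: "mono E" and inf: "infinite {n. E (E n) \<le> f n}"
  shows "infinite {k. E (scale f k) \<le> scale f (Suc k)}"
  unfolding infinite_nat_iff_unbounded_le
proof
  fix k0
  obtain n where n: "scale f k0 \<le> n" "E (E n) \<le> f n"
    using inf unfolding infinite_nat_iff_unbounded_le by blast
  have "\<exists>k. n < scale f k"
    using strict_mono_imp_increasing[OF strict_mono_scale, of "Suc n" f] by (auto simp: Suc_le_eq simp del: scale.simps)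
  then obtain k where k: "scale f k \<le> n" "n < scale f (Suc k)"
    using nat_induct[of "\<lambda>k. scale f k \<le> n"] by (metis le0 not_le scale.simps(1))
  have "scale f k0 < scale f (Suc k)"
    using n k by linarith
  then have "k0 \<le> k"
    using strict_mono_less[OF strict_mono_scale] by (metis less_Suc_eq_le)
  show "\<exists>k\<ge>k0. k \<in> {k. E (scale f k) \<le> scale f (Suc k)}"
  proof (cases "E (scale f k) \<le> scale f (Suc k)")
    case True
    then show ?thesis
      using \<open>k0 \<le> k\<close> by blast
  next
    case False
    then have "scale f (Suc k) \<le> E n"
      using monoD[OF E k(1)] by linarith
    then have "E (scale f (Suc k)) \<le> f n"
      using n monoD[OF E] le_trans by blast
    also have "\<dots> \<le> scale f (Suc (Suc k))"
      using k by (intro scale_Suc_ge) simp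
    finally show ?thesis
      using \<open>k0 \<le> k\<close> by (intro exI[of _ "Suc k"]) simp
  qed
qed

section \<open>Reals built from digit blocks\<close>

text \<open>For strictly increasing \<open>j\<close>, this is the number in [0, 1] whose binary
  digits from position \<open>j l\<close> up to \<open>j (Suc l)\<close> spell
  \<open>\<delta> l\<close>. The \<open>mod\<close> cuts words to block length, so blocks never
  carry into each other.\<close>

definition dyadic_sum :: "(nat \<Rightarrow> nat) \<Rightarrow> (nat \<Rightarrow> nat) \<Rightarrow> real"
  where "dyadic_sum j \<delta> = (SUP k. \<Sum>l<k. real (\<delta> l mod 2 ^ (j (Suc l) - j l)) / 2 ^ j (Suc l))"

text \<open>The partial sums \<open>P l\<close> increase while \<open>P l + 1 / 2 ^ j l\<close>
  decreases, so the value lies between the two at \<open>l = Suc k\<close>. \<open>N\<close>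
  collects the digits before block \<open>k\<close>.\<close>

lemma dyadic_sum_block:
  assumes j: "strict_mono j" and d: "\<delta> k < 2 ^ (j (Suc k) - j k)"
  obtains N :: nat where "N < 2 ^ j k"
    "dyadic_sum j \<delta> \<in> {real N / 2 ^ j k + real (\<delta> k) / 2 ^ j (Suc k)..
      real N / 2 ^ j k + real (\<delta> k + 1) / 2 ^ j (Suc k)}"
proof -
  define q where "q l = \<delta> l mod 2 ^ (j (Suc l) - j l)" for l
  define P where "P k = (\<Sum>l<k. real (q l) / 2 ^ j (Suc l))" for k
  have x: "dyadic_sum j \<delta> = (SUP k. P k)"
    by (simp add: dyadic_sum_def P_def q_def)
  have j_Suc: "j l + (j (Suc l) - j l) = j (Suc l)" for l
    using strict_monoD[OF j, of l "Suc l"] by simp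
  have split_nat: "(2::nat) ^ j (Suc l) = 2 ^ j l * 2 ^ (j (Suc l) - j l)"
    and split_real: "(2::real) ^ j (Suc l) = 2 ^ j l * 2 ^ (j (Suc l) - j l)" for l
    by (metis j_Suc power_add)+
  have q: "q l + 1 \<le> 2 ^ (j (Suc l) - j l)" for l
    by (simp add: q_def Suc_le_eq)
  have rat: "\<exists>N<2 ^ j k. P k = real N / 2 ^ j k" for k
  proof (induction k)
    case 0
    then show ?case by (auto simp: P_def)
  next
    case (Suc k)
    then obtain N where N: "N < 2 ^ j k" "P k = real N / 2 ^ j k"
      by blast
    let ?e = "2 ^ (j (Suc k) - j k) :: nat"
    have "N * ?e + q k < (N + 1) * ?e"
      using q[of k] by simp
    also have "\<dots> \<le> 2 ^ j k * ?e"
      using N by (intro mult_right_mono) auto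
    also have "\<dots> = 2 ^ j (Suc k)"
      using split_nat[of k] by simp
    finally have 1: "N * ?e + q k < 2 ^ j (Suc k)" .
    have "P (Suc k) = real (N * ?e + q k) / 2 ^ j (Suc k)"
      using split_real[of k] by (simp add: P_def N(2)[unfolded P_def] field_simps)
    with 1 show ?case by blast
  qed
  have "P (Suc l) + 1 / 2 ^ j (Suc l) \<le> P l + 1 / 2 ^ j l" for l
  proof -
    have "real (q l) + 1 \<le> 2 ^ (j (Suc l) - j l)"
      using of_nat_mono[OF q[of l], where 'a = real] by simp
    then have "(real (q l) + 1) / 2 ^ j (Suc l) \<le> 2 ^ (j (Suc l) - j l) / 2 ^ j (Suc l)"
      by (intro divide_right_mono) auto
    also have "\<dots> = 1 / 2 ^ j l"
      using split_real[of l] by simp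
    finally show ?thesis
      by (simp add: P_def add_divide_distrib)
  qed
  then have dec: "P m + 1 / 2 ^ j m \<le> P l + 1 / 2 ^ j l" if "l \<le> m" for l m
    using that lift_Suc_antimono_le[of "\<lambda>l. P l + 1 / 2 ^ j l"] by blast
  have inc: "P l \<le> P m" if "l \<le> m" for l m
    unfolding P_def using that by (intro sum_mono2) auto
  have up: "P m \<le> P l + 1 / 2 ^ j l" for l m
  proof (cases "l \<le> m")
    case True
    then show ?thesis
      using dec[of l m] by (smt (verit) divide_nonneg_nonneg zero_le_power)
  next
    case False
    then show ?thesis
      using inc[of m l] by (smt (verit) divide_nonneg_nonneg nle_le zero_le_power)
  qed
  have lower: "P l \<le> dyadic_sum j \<delta>" for l
    unfolding x using up[of _ 0] by (intro cSUP_upper bdd_aboveI2) auto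
  have upper: "dyadic_sum j \<delta> \<le> P l + 1 / 2 ^ j l" for l
    unfolding x using up by (intro cSUP_least) auto
  obtain N where N: "N < 2 ^ j k" "P k = real N / 2 ^ j k"
    using rat by blast
  have "P (Suc k) = real N / 2 ^ j k + real (\<delta> k) / 2 ^ j (Suc k)"
    using d N(2) by (simp add: P_def q_def)
  then show thesis
    using that[OF N(1)] lower[of "Suc k"] upper[of "Suc k"] by (auto simp: add_divide_distrib)
qed

text \<open>Rounding \<open>u * 2 ^ e\<close> up loses less than one of the two units of length
  available; \<open>v \<le> 1 / 2 ^ m\<close> makes \<open>c\<close> fit into \<open>e - m\<close>
  digits.\<close>

lemma dyadic_subinterval:
  fixes u v :: real
  assumes "0 \<le> u" "v \<le> 1 / 2 ^ m" "2 / 2 ^ e \<le> v - u" "m \<le> e"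
  obtains c :: nat where "c < 2 ^ (e - m)" "{real c / 2 ^ e..real (c + 1) / 2 ^ e} \<subseteq> {u..v}"
proof
  define c where "c = nat \<lceil>u * 2 ^ e\<rceil>"
  have c: "u * 2 ^ e \<le> real c" "real c < u * 2 ^ e + 1"
    using assms(1) by (auto simp: c_def intro: real_nat_ceiling_ge) linarith
  have "2 \<le> (v - u) * 2 ^ e"
    using assms(3) by (simp add: field_simps)
  then have v: "real c + 1 \<le> v * 2 ^ e"
    using c by (simp add: algebra_simps)
  show "{real c / 2 ^ e..real (c + 1) / 2 ^ e} \<subseteq> {u..v}"
    using c v by (auto simp: field_simps intro: order_trans)
  have "v * 2 ^ e \<le> 1 / 2 ^ m * 2 ^ e"
    using assms(2) by (intro mult_right_mono) auto
  also have "\<dots> = 2 ^ (e - m)"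
    using assms(4) by (simp add: power_diff)
  finally have "real c < 2 ^ (e - m)"
    using v by linarith
  then show "c < 2 ^ (e - m)"
    by (metis of_nat_less_iff of_nat_numeral of_nat_power)
qed

text \<open>The finitely many translates of the given sets have a dense open intersection, so one
  digit \<open>c\<close> serves all prefixes \<open>N\<close>.\<close>

lemma digit_for_all_prefixes:
  fixes \<U> :: "real set set"
  assumes fin: "finite \<U>" and od: "\<And>U. U \<in> \<U> \<Longrightarrow> open U \<and> closure U = UNIV"
  obtains E where "\<And>e. e \<ge> E \<Longrightarrow> \<exists>c::nat. c < 2 ^ (e - m) \<and> (\<forall>U\<in>\<U>. \<forall>N::nat. N < 2 ^ m \<longrightarrow>
    {real N / 2 ^ m + real c / 2 ^ e..real N / 2 ^ m + real (c + 1) / 2 ^ e} \<subseteq> U)"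
proof -
  define \<T> where "\<T> = (\<lambda>(U, N). (\<lambda>x. x - real N / 2 ^ m) ` U) ` (\<U> \<times> {..<2 ^ m :: nat})"
  have finT: "finite \<T>"
    using fin by (simp add: \<T>_def)
  have T: "open T" "closure T = UNIV" if "T \<in> \<T>" for T
    using that od
    by (auto simp: \<T>_def open_translation_subtract closure_translation_subtract
        intro!: surjI[where f = "\<lambda>x. x + _"])
  have "UNIV \<subseteq> closure (\<Inter>\<T>)"
    using finT T by (intro Baire) (auto intro: countable_finite)
  \<comment> \<open>Points of this interval are the possible continuations of a prefix of
    \<open>m\<close> digits.\<close>
  moreover have "open {0<..<1 / 2 ^ m :: real}" "{0<..<1 / 2 ^ m :: real} \<noteq> {}"
    by (simp_all add: not_le)
  ultimately have "{0<..<1 / 2 ^ m} \<inter> \<Inter>\<T> \<noteq> {}"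
    using open_Int_closure_eq_empty by blast
  then obtain z where z: "z \<in> {0<..<1 / 2 ^ m} \<inter> \<Inter>\<T>"
    by blast
  have "open ({0<..<1 / 2 ^ m} \<inter> \<Inter>\<T>)"
    using finT T by (intro open_Int open_Inter) auto
  then obtain \<epsilon> where \<epsilon>: "\<epsilon> > 0" "cball z \<epsilon> \<subseteq> {0<..<1 / 2 ^ m} \<inter> \<Inter>\<T>"
    using z open_contains_cball by blast
  then have sub: "{z - \<epsilon>..z + \<epsilon>} \<subseteq> {0<..<1 / 2 ^ m} \<inter> \<Inter>\<T>"
    by (simp add: cball_eq_atLeastAtMost)
  obtain E0 where E0: "1 / 2 ^ E0 < \<epsilon>"
    using real_arch_pow_inv[of \<epsilon> "1 / 2"] \<epsilon>(1) by (auto simp: power_one_over)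
  show thesis
  proof
    fix e assume e: "e \<ge> max m E0"
    have "1 / 2 ^ e \<le> (1 / 2 ^ E0 :: real)"
      using e by (intro divide_left_mono power_increasing) auto
    then have "2 / 2 ^ e \<le> (z + \<epsilon>) - (z - \<epsilon>)"
      using E0 by simp
    moreover have "0 \<le> z - \<epsilon>" "z + \<epsilon> \<le> 1 / 2 ^ m"
      using subsetD[OF sub, of "z - \<epsilon>"] subsetD[OF sub, of "z + \<epsilon>"] \<epsilon>(1) by auto
    ultimately obtain c :: nat where c: "c < 2 ^ (e - m)"
        "{real c / 2 ^ e..real (c + 1) / 2 ^ e} \<subseteq> {z - \<epsilon>..z + \<epsilon>}"
      using e dyadic_subinterval[of "z - \<epsilon>" "z + \<epsilon>" m e] by auto
    have "y \<in> U" if "U \<in> \<U>" "N < 2 ^ m"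
      "y \<in> {real N / 2 ^ m + real c / 2 ^ e..real N / 2 ^ m + real (c + 1) / 2 ^ e}" for U y and N :: nat
    proof -
      have "y - real N / 2 ^ m \<in> {real c / 2 ^ e..real (c + 1) / 2 ^ e}"
        using that(3) by auto
      then have "y - real N / 2 ^ m \<in> \<Inter>\<T>"
        using c(2) sub by blast
      moreover have "(\<lambda>x. x - real N / 2 ^ m) ` U \<in> \<T>"
        unfolding \<T>_def using that by force
      ultimately show ?thesis
        by auto
    qed
    with c(1) show "\<exists>c::nat. c < 2 ^ (e - m) \<and> (\<forall>U\<in>\<U>. \<forall>N::nat. N < 2 ^ m \<longrightarrow>
      {real N / 2 ^ m + real c / 2 ^ e..real N / 2 ^ m + real (c + 1) / 2 ^ e} \<subseteq> U)"
      by blast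
  qed
qed

section \<open>The nonmeager set\<close>

lemma meager_disjoint_dense_open:
  assumes "meager X"
  obtains D :: "nat \<Rightarrow> 'a::topological_space set"
  where "\<forall>n. open (D n) \<and> closure (D n) = UNIV" "X \<inter> (\<Inter>n. D n) = {}"
proof -
  obtain \<N> where N: "countable \<N>" "\<And>N. N \<in> \<N> \<Longrightarrow> nowhere_dense N" "X = \<Union>\<N>"
    using assms unfolding meager_def by blast
  \<comment> \<open>Adding the empty set makes the family nonempty, so that
    \<open>from_nat_into\<close> enumerates it.\<close>
  let ?\<M> = "insert {} \<N>"
  let ?D = "\<lambda>n. - closure (from_nat_into ?\<M> n)"
  have rng: "range (from_nat_into ?\<M>) = ?\<M>"
    using N(1) by (intro range_from_nat_into) auto
  show thesis
  proof
    have "nowhere_dense (from_nat_into ?\<M> n)" for n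
      using N(2) from_nat_into[of ?\<M> n] by (auto simp: nowhere_dense_def)
    then show "\<forall>n. open (?D n) \<and> closure (?D n) = UNIV"
      by (auto simp: nowhere_dense_def closure_complement)
  next
    have "X \<subseteq> \<Union>(range (from_nat_into ?\<M>))"
      unfolding rng using N(3) by blast
    then show "X \<inter> (\<Inter>n. ?D n) = {}"
      using closure_subset by blast
  qed
qed

lemma finite_imp_meager:
  fixes X :: "real set"
  assumes "finite X"
  shows "meager X"
  unfolding meager_def
proof (intro exI conjI ballI)
  show "countable ((\<lambda>x. {x}) ` X)"
    using assms by (simp add: countable_finite)
  show "X = \<Union>((\<lambda>x. {x}) ` X)"
    by simp
qed (auto simp: nowhere_dense_def)

lemma nonmeager_from_guessing:
  fixes \<Phi> :: "'i set" and f :: "'i \<Rightarrow> nat \<Rightarrow> nat" and H :: "nat \<Rightarrow> nat"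
  assumes guess: "\<And>g. \<exists>a\<in>\<Phi>. infinite {n. \<exists>i. f a n = g i \<and> n < H i}"
  obtains X :: "real set" where "\<not> meager X" "|X| \<le>o |\<Phi> \<times> \<Phi>|"
proof -
  have "\<forall>b. \<exists>\<delta>. \<forall>K c.
      infinite {n. n < card (fst ` set (from_nat (f b n) :: (nat \<times> nat) list)) \<and>
        (\<forall>(k, v)\<in>set (from_nat (f b n) :: (nat \<times> nat) list). k \<in> K \<and> v = c k)}
      \<longrightarrow> infinite {k\<in>K. \<delta> k = c k}"
    by (intro allI digits_from_guesses)
  from choice[OF this] obtain \<delta> :: "'i \<Rightarrow> nat \<Rightarrow> nat" where \<delta>: "\<And>b K c.
      infinite {n. n < card (fst ` set (from_nat (f b n) :: (nat \<times> nat) list)) \<and>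
        (\<forall>(k, v)\<in>set (from_nat (f b n) :: (nat \<times> nat) list). k \<in> K \<and> v = c k)}
      \<Longrightarrow> infinite {k\<in>K. \<delta> b k = c k}"
    by (elim exE) iprover
  define X where "X = (\<lambda>(a, b). dyadic_sum (scale (f a)) (\<delta> b)) ` (\<Phi> \<times> \<Phi>)"
  have "\<not> meager X"
  proof
    assume "meager X"
    then obtain D :: "nat \<Rightarrow> real set" where D: "\<forall>n. open (D n) \<and> closure (D n) = UNIV" "X \<inter> (\<Inter>n. D n) = {}"
      by (rule meager_disjoint_dense_open)
    \<comment> \<open>The word \<open>c\<close> at positions \<open>m\<close> to \<open>e\<close>
      forces a real into \<open>D 0\<close>, ..., \<open>D m\<close>, whatever its first
      \<open>m\<close> digits.\<close>
    define good where "good m e c \<longleftrightarrow> c < 2 ^ (e - m) \<and> (\<forall>U\<in>D ` {..m}. \<forall>N::nat. N < 2 ^ m \<longrightarrow>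
      {real N / 2 ^ m + real c / 2 ^ e..real N / 2 ^ m + real (c + 1) / 2 ^ e} \<subseteq> U)" for m e and c :: nat
    have "\<exists>E. \<forall>e\<ge>E. \<exists>c. good m e c" for m
      unfolding good_def using D(1) by (rule_tac digit_for_all_prefixes[of "D ` {..m}" m]) auto
    then obtain E0 where E0: "\<And>m e. E0 m \<le> e \<Longrightarrow> \<exists>c. good m e c"
      by metis
    \<comment> \<open>Summing gives a monotone majorant of \<open>E0\<close>.\<close>
    define E where "E m = (\<Sum>i\<le>m. E0 i)" for m
    have monoE: "mono E"
      unfolding E_def by (intro monoI sum_mono2) auto
    have E0E: "E0 m \<le> E m" for m
      unfolding E_def by (rule member_le_sum) auto
    \<comment> \<open>A guess at index \<open>n < H i\<close> has value
      \<open>E (E (H i)) \<ge> E (E n)\<close>, as monotonicity turns the index bound into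
      growth.\<close>
    obtain a where a: "a \<in> \<Phi>" "infinite {n. \<exists>i. f a n = E (E (H i)) \<and> n < H i}"
      using guess[of "\<lambda>i. E (E (H i))"] by blast
    have "{n. \<exists>i. f a n = E (E (H i)) \<and> n < H i} \<subseteq> {n. E (E n) \<le> f a n}"
      using monoD[OF monoE] by (auto simp: less_imp_le)
    then have "infinite {n. E (E n) \<le> f a n}"
      using a(2) finite_subset by blast
    define j where "j = scale (f a)"
    define K where "K = {k. E (j k) \<le> j (Suc k)}"
    have K: "infinite K"
      unfolding K_def j_def by (rule infinite_long_blocks[OF monoE]) fact
    have "\<exists>c. good (j k) (j (Suc k)) c" if "k \<in> K" for k
      using that E0 E0E le_trans unfolding K_def by blast
    then obtain c where c: "\<And>k. k \<in> K \<Longrightarrow> good (j k) (j (Suc k)) (c k)"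
      by metis
    \<comment> \<open>\<open>H i\<close> distinct long blocks with their words: more than
      \<open>n\<close> of them whenever a guess at index \<open>n < H i\<close> is correct.\<close>
    define L where "L i = map (\<lambda>l. (enumerate K l, c (enumerate K l))) [0..<H i]" for i
    have cardL: "card (fst ` set (L i)) = H i" for i
    proof -
      have "fst ` set (L i) = enumerate K ` {..<H i}"
        by (auto simp: L_def image_image atLeast0LessThan)
      then show ?thesis
        using inj_enumerate[OF K] by (simp add: card_image inj_on_subset)
    qed
    obtain b where b: "b \<in> \<Phi>" "infinite {n. \<exists>i. f b n = to_nat (L i) \<and> n < H i}"
      using guess[of "\<lambda>i. to_nat (L i)"] by blast
    have "{n. \<exists>i. f b n = to_nat (L i) \<and> n < H i} \<subseteq>
      {n. n < card (fst ` set (from_nat (f b n) :: (nat \<times> nat) list)) \<and>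
        (\<forall>(k, v)\<in>set (from_nat (f b n) :: (nat \<times> nat) list). k \<in> K \<and> v = c k)}"
      using cardL enumerate_in_set[OF K] by (auto simp: L_def)
    then have "infinite {k\<in>K. \<delta> b k = c k}"
      using b(2) finite_subset by (intro \<delta>) blast
    \<comment> \<open>A block \<open>k \<ge> n\<close> with the right word suffices, since
      \<open>n \<le> k \<le> j k\<close> places \<open>D n\<close> among the sets that it
      controls.\<close>
    have "dyadic_sum j (\<delta> b) \<in> D n" for n
    proof -
      obtain k where k: "n \<le> k" "k \<in> K" "\<delta> b k = c k"
        using \<open>infinite {k\<in>K. \<delta> b k = c k}\<close> unfolding infinite_nat_iff_unbounded_le by blast
      have "k \<le> j k"
        unfolding j_def by (rule strict_mono_imp_increasing[OF strict_mono_scale])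
      then have "D n \<in> D ` {..j k}"
        using k(1) by auto
      moreover have "good (j k) (j (Suc k)) (\<delta> b k)"
        using c k by simp
      moreover from this obtain N :: nat where "N < 2 ^ j k"
        "dyadic_sum j (\<delta> b) \<in> {real N / 2 ^ j k + real (\<delta> b k) / 2 ^ j (Suc k)..
          real N / 2 ^ j k + real (\<delta> b k + 1) / 2 ^ j (Suc k)}"
        using dyadic_sum_block[of j "\<delta> b" k] strict_mono_scale unfolding good_def j_def by blast
      ultimately show ?thesis
        unfolding good_def by blast
    qed
    moreover have "dyadic_sum j (\<delta> b) \<in> X"
      using a b by (force simp: X_def j_def)
    ultimately show False
      using D(2) by blast
  qed
  moreover have "|X| \<le>o |\<Phi> \<times> \<Phi>|"
    unfolding X_def by (rule card_of_image)
  ultimately show thesis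
    by (rule that)
qed

section \<open>Comparison of cardinals\<close>

theorem mainTheorem1:
  fixes \<Phi> :: "(nat \<Rightarrow> real) set"
  assumes "\<And>a. a \<in> \<Phi> \<Longrightarrow> filterlim a at_top sequentially"
    and "\<And>U. open U \<Longrightarrow> \<not> bdd_above U \<Longrightarrow> \<exists>a\<in>\<Phi>. infinite {n. a n \<in> U}"
    and "bounded_family (cover_fun ` \<Phi>)"
    and "\<And>a n. a \<in> \<Phi> \<Longrightarrow> n \<noteq> 0 \<Longrightarrow> 0 < a (n + 1) - a n \<and> a (n + 1) - a n \<le> a n - a (n - 1)"
  shows "non_M \<le>o |\<Phi>|"
proof -
  obtain H where H: "\<And>a. a \<in> \<Phi> \<Longrightarrow> \<exists>i\<^sub>0. \<forall>i\<ge>i\<^sub>0. \<forall>n. a n < real i \<longrightarrow> n < H i"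
    using eventually_few_terms_below[OF assms(1,3,4)] by blast
  have "\<exists>a\<in>\<Phi>. infinite {n. \<exists>i. nat \<lfloor>1 / frac (a n)\<rfloor> - 1 = g i \<and> n < H (Suc i)}" for g
    by (rule guessing_sequences[OF assms(1,2) H])
  then obtain X :: "real set" where X: "\<not> meager X" "|X| \<le>o |\<Phi> \<times> \<Phi>|"
    using nonmeager_from_guessing[of \<Phi> "\<lambda>a n. nat \<lfloor>1 / frac (a n)\<rfloor> - 1" "\<lambda>i. H (Suc i)"] by blast
  \<comment> \<open>Infinity of \<Phi> lets the square \<open>\<Phi> \<times> \<Phi>\<close> be
    replaced by \<Phi>; a finite \<Phi> would make \<open>X\<close> finite, hence meager.\<close>
  have "infinite \<Phi>"
  proof
    assume "finite \<Phi>"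
    then have "finite X"
      using card_of_ordLeq_finite[OF X(2)] by blast
    then show False
      using finite_imp_meager X(1) by blast
  qed
  then have "|\<Phi> \<times> \<Phi>| =o |\<Phi>|"
    by (rule card_of_Times_same_infinite)
  moreover have "non_M \<le>o |X|"
    using non_M_least X(1) by (auto simp: nonmeager_cards_def)
  ultimately show ?thesis
    using X(2) ordLeq_ordIso_trans ordLeq_transitive by blast
qed

end
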